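(* Let $k$ be a field, $Q$ a quiver with finitely many vertices, and $I\subseteq kQ$ a two-sided ideal. Then there exists a reduction system $\mathcal R$ which satisfies condition $(\lozenge)$ for $I$.
   Context: $Q_{\ge0}$ is the set of all paths of $Q$. A path $p$ divides a path $q$ if $q=apb$ for some paths $a,b$. An element $f\in kQ$ is parallel to a path $s$ if all paths in the support of $f$ have the same source and target as $s$. A reduction system is a set $\mathcal R=\{(s_i,f_i)\}_{i\in\Gamma}$ with $s_i\in Q_{\ge0}$, $f_i\in kQ$ parallel to $s_i$, $f_i\ne s_i$, and $s_i$ not dividing $s_j$ for $i\neq j$. For $(s,f)\in\mathcal R$ and paths $a,c$ with $asc\ne0$ in $kQ$, the basic reduction $r_{a,s,c}:kQ\to kQ$ is the linear map with $r_{a,s,c}(asc)=afc$ and $r_{a,s,c}(q)=q$ for every path $q\ne asc$. A reduction $r=(r_n,\dots,r_1)$ is a finite sequence of basic reductions, acting on $kQ$ as $r_n\circ\cdots\circ r_1$. $x\in kQ$ is irreducible if $r(x)=x$ for all basic reductions $r$. A path $p$ is reduction-finite if for every infinite sequence $(r_i)_{i\in\mathbb N}$ of basic reductions the sequence $r_n\circ\cdots\circ r_1(p)$ is eventually constant in $n$; it is reduction-unique if it is reduction-finite and $r(p)=r'(p)$ for any two reductions $r,r'$ with $r(p),r'(p)$ both irreducible. $\mathcal R$ satisfies $(\lozenge)$ for $I$ if $I$ is the two-sided ideal generated by $\{s-f\}_{(s,f)\in\mathcal R}$, every path is reduction-unique, and $f$ is irreducible for each $(s,f)\in\mathcal R$.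 *)

theory Defs
  imports "Graph_Theory.Arc_Walk" "HOL-Library.Poly_Mapping" "HOL-Algebra.Ideal"
begin

text \<open>
  A quiver is a directed multigraph (\<^locale>\<open>wf_digraph\<close>), possibly with loops and with infinitely
  many arrows. A path is its source together with its list of arrows, so that the trivial path at
  a vertex \<open>v\<close> is \<open>(v, [])\<close>. Paths are composed from left to right: in \<open>pq\<close> the target of \<open>p\<close>
  is the source of \<open>q\<close>.
\<close>

type_synonym ('v, 'e) qpath = "'v \<times> 'e list"

definition path_source :: "('v, 'e) qpath \<Rightarrow> 'v" where
  "path_source p = fst p"

definition path_target :: "('v, 'e) pre_digraph \<Rightarrow> ('v, 'e) qpath \<Rightarrow> 'v" where
  "path_target Q p = last (pre_digraph.awalk_verts Q (fst p) (snd p))"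

definition paths :: "('v, 'e) pre_digraph \<Rightarrow> ('v, 'e) qpath set" where
  "paths Q = {p. pre_digraph.awalk Q (path_source p) (snd p) (path_target Q p)}"

text \<open>Only meaningful under \<open>composable\<close>.\<close>

definition path_comp :: "('v, 'e) qpath \<Rightarrow> ('v, 'e) qpath \<Rightarrow> ('v, 'e) qpath" where
  "path_comp p q = (fst p, snd p @ snd q)"

definition composable :: "('v, 'e) pre_digraph \<Rightarrow> ('v, 'e) qpath \<Rightarrow> ('v, 'e) qpath \<Rightarrow> bool" where
  "composable Q p q \<longleftrightarrow> path_target Q p = path_source q"

definition path_divides :: "('v, 'e) pre_digraph \<Rightarrow> ('v, 'e) qpath \<Rightarrow> ('v, 'e) qpath \<Rightarrow> bool" where
  "path_divides Q p q \<longleftrightarrow>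
     (\<exists>a\<in>paths Q. \<exists>b\<in>paths Q. composable Q a p \<and> composable Q p b \<and>
        q = path_comp (path_comp a p) b)"


section \<open>The path algebra\<close>

abbreviation path_elem :: "('v, 'e) qpath \<Rightarrow> ('v, 'e) qpath \<Rightarrow>\<^sub>0 'k::field" where
  "path_elem p \<equiv> Poly_Mapping.single p 1"

definition pa_mult :: "('v, 'e) pre_digraph \<Rightarrow> (('v, 'e) qpath \<Rightarrow>\<^sub>0 'k::field) \<Rightarrow>
    (('v, 'e) qpath \<Rightarrow>\<^sub>0 'k) \<Rightarrow> (('v, 'e) qpath \<Rightarrow>\<^sub>0 'k)" where
  "pa_mult Q x y =
     (\<Sum>p\<in>Poly_Mapping.keys x. \<Sum>q\<in>Poly_Mapping.keys y.
        if composable Q p q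
        then Poly_Mapping.single (path_comp p q) (Poly_Mapping.lookup x p * Poly_Mapping.lookup y q)
        else 0)"

text \<open>
  The unit is the sum of the trivial paths, so this is a ring only when \<open>Q\<close> has finitely many
  vertices; see \<open>ring_path_algebra\<close> below.
\<close>

definition path_algebra ::
    "('v, 'e) pre_digraph \<Rightarrow> (('v, 'e) qpath \<Rightarrow>\<^sub>0 'k::field) ring" where
  "path_algebra Q =
     \<lparr>carrier = {x. Poly_Mapping.keys x \<subseteq> paths Q},
      mult = pa_mult Q,
      one = (\<Sum>v\<in>verts Q. path_elem (v, [])),
      zero = 0,
      add = (+)\<rparr>"


section \<open>Reduction systems\<close>

definition parallel :: "('v, 'e) pre_digraph \<Rightarrow> (('v, 'e) qpath \<Rightarrow>\<^sub>0 'k::field) \<Rightarrow>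
    ('v, 'e) qpath \<Rightarrow> bool" where
  "parallel Q f s \<longleftrightarrow>
     (\<forall>p\<in>Poly_Mapping.keys f. path_source p = path_source s \<and> path_target Q p = path_target Q s)"

type_synonym ('v, 'e, 'k) red_sys = "(('v, 'e) qpath \<times> (('v, 'e) qpath \<Rightarrow>\<^sub>0 'k)) set"

text \<open>
  A family \<open>(s\<^sub>i, f\<^sub>i)\<close> as below is injective, since every path divides itself; hence a
  reduction system can be taken to be a set of pairs.
\<close>

definition reduction_system :: "('v, 'e) pre_digraph \<Rightarrow> ('v, 'e, 'k::field) red_sys \<Rightarrow> bool" where
  "reduction_system Q R \<longleftrightarrow>
     (\<forall>(s, f)\<in>R. s \<in> paths Q \<and> f \<in> carrier (path_algebra Q) \<and> parallel Q f s \<and> f \<noteq> path_elem s) \<and>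
     (\<forall>(s, f)\<in>R. \<forall>(s', f')\<in>R. (s, f) \<noteq> (s', f') \<longrightarrow> \<not> path_divides Q s s')"

text \<open>
  The linear map with \<open>asc \<mapsto> afc\<close> that fixes every other path; \<open>Poly_Mapping.map ((*) l)\<close> is
  multiplication by the scalar \<open>l\<close>.
\<close>

definition basic_reduction :: "('v, 'e) pre_digraph \<Rightarrow> ('v, 'e) qpath \<Rightarrow>
    ('v, 'e) qpath \<times> (('v, 'e) qpath \<Rightarrow>\<^sub>0 'k::field) \<Rightarrow> ('v, 'e) qpath \<Rightarrow>
    (('v, 'e) qpath \<Rightarrow>\<^sub>0 'k) \<Rightarrow> (('v, 'e) qpath \<Rightarrow>\<^sub>0 'k)" where
  "basic_reduction Q a sf c x =
     (\<Sum>q\<in>Poly_Mapping.keys x. Poly_Mapping.map ((*) (Poly_Mapping.lookup x q))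
        (if q = path_comp (path_comp a (fst sf)) c
         then pa_mult Q (pa_mult Q (path_elem a) (snd sf)) (path_elem c)
         else path_elem q))"

text \<open>Composability expresses \<open>asc \<noteq> 0\<close> in \<open>kQ\<close>; see \<open>pa_mult_path_elem\<close> below.\<close>

definition basic_reductions :: "('v, 'e) pre_digraph \<Rightarrow> ('v, 'e, 'k::field) red_sys \<Rightarrow>
    ((('v, 'e) qpath \<Rightarrow>\<^sub>0 'k) \<Rightarrow> (('v, 'e) qpath \<Rightarrow>\<^sub>0 'k)) set" where
  "basic_reductions Q R =
     {basic_reduction Q a (s, f) c | a s f c.
        (s, f) \<in> R \<and> a \<in> paths Q \<and> c \<in> paths Q \<and> composable Q a s \<and> composable Q s c}"

text \<open>The list \<open>[r\<^sub>n, \<dots>, r\<^sub>1]\<close> acts as \<open>r\<^sub>n \<circ> \<dots> \<circ> r\<^sub>1\<close>; the empty reduction is allowed.\<close>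

definition reductions :: "('v, 'e) pre_digraph \<Rightarrow> ('v, 'e, 'k::field) red_sys \<Rightarrow>
    ((('v, 'e) qpath \<Rightarrow>\<^sub>0 'k) \<Rightarrow> (('v, 'e) qpath \<Rightarrow>\<^sub>0 'k)) set" where
  "reductions Q R = {foldr (\<circ>) rs id | rs. set rs \<subseteq> basic_reductions Q R}"

definition red_irreducible :: "('v, 'e) pre_digraph \<Rightarrow> ('v, 'e, 'k::field) red_sys \<Rightarrow>
    (('v, 'e) qpath \<Rightarrow>\<^sub>0 'k) \<Rightarrow> bool" where
  "red_irreducible Q R x \<longleftrightarrow> (\<forall>r\<in>basic_reductions Q R. r x = x)"

primrec apply_seq :: "(nat \<Rightarrow> 'b \<Rightarrow> 'b) \<Rightarrow> nat \<Rightarrow> 'b \<Rightarrow> 'b" where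
  "apply_seq r 0 x = x"
| "apply_seq r (Suc n) x = r n (apply_seq r n x)"

definition reduction_finite :: "('v, 'e) pre_digraph \<Rightarrow> ('v, 'e, 'k::field) red_sys \<Rightarrow>
    ('v, 'e) qpath \<Rightarrow> bool" where
  "reduction_finite Q R p \<longleftrightarrow>
     (\<forall>r. (\<forall>i. r i \<in> basic_reductions Q R) \<longrightarrow>
        (\<exists>N. \<forall>n\<ge>N. apply_seq r n (path_elem p) = apply_seq r N (path_elem p)))"

definition reduction_unique :: "('v, 'e) pre_digraph \<Rightarrow> ('v, 'e, 'k::field) red_sys \<Rightarrow>
    ('v, 'e) qpath \<Rightarrow> bool" where
  "reduction_unique Q R p \<longleftrightarrow>
     reduction_finite Q R p \<and>
     (\<forall>r\<in>reductions Q R. \<forall>r'\<in>reductions Q R.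
        red_irreducible Q R (r (path_elem p)) \<and> red_irreducible Q R (r' (path_elem p)) \<longrightarrow>
        r (path_elem p) = r' (path_elem p))"

definition diamond_condition :: "('v, 'e) pre_digraph \<Rightarrow> ('v, 'e, 'k::field) red_sys \<Rightarrow>
    (('v, 'e) qpath \<Rightarrow>\<^sub>0 'k) set \<Rightarrow> bool" where
  "diamond_condition Q R I \<longleftrightarrow>
     I = genideal (path_algebra Q) {path_elem s - f | s f. (s, f) \<in> R} \<and>
     (\<forall>p\<in>paths Q. reduction_unique Q R p) \<and>
     (\<forall>(s, f)\<in>R. red_irreducible Q R f)"


section \<open>The path algebra of a quiver with finitely many vertices is a ring\<close>

lemma pa_mult_path_elem:
  "pa_mult Q (path_elem p) (path_elem q) =
     (if composable Q p q then path_elem (path_comp p q) else (0 :: _ \<Rightarrow>\<^sub>0 'k::field))"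
  by (simp add: pa_mult_def)

lemma pa_mult_superset:
  assumes "finite A" "Poly_Mapping.keys x \<subseteq> A" "finite B" "Poly_Mapping.keys y \<subseteq> B"
  shows "pa_mult Q x y =
     (\<Sum>p\<in>A. \<Sum>q\<in>B.
        if composable Q p q
        then Poly_Mapping.single (path_comp p q) (Poly_Mapping.lookup x p * Poly_Mapping.lookup y q)
        else 0)"
proof -
  have *: "(\<Sum>q\<in>Poly_Mapping.keys y.
        if composable Q p q
        then Poly_Mapping.single (path_comp p q) (Poly_Mapping.lookup x p * Poly_Mapping.lookup y q)
        else 0) =
      (\<Sum>q\<in>B.
        if composable Q p q
        then Poly_Mapping.single (path_comp p q) (Poly_Mapping.lookup x p * Poly_Mapping.lookup y q)
        else 0)" for p
    using assms by (intro sum.mono_neutral_left) (auto simp: in_keys_iff)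
  show ?thesis
    unfolding pa_mult_def *
    using assms by (intro sum.mono_neutral_left) (auto simp: in_keys_iff intro!: sum.neutral)
qed

lemma pa_mult_add_left: "pa_mult Q (x + y) z = pa_mult Q x z + pa_mult Q y z"
proof -
  let ?A = "Poly_Mapping.keys x \<union> Poly_Mapping.keys y"
  have A: "finite ?A" "Poly_Mapping.keys (x + y) \<subseteq> ?A" by (auto simp: keys_add)
  show ?thesis
    unfolding pa_mult_superset[OF A finite_keys subset_refl]
      pa_mult_superset[OF A(1) Un_upper1 finite_keys subset_refl]
      pa_mult_superset[OF A(1) Un_upper2 finite_keys subset_refl]
      sum.distrib[symmetric]
    by (intro sum.cong refl) (auto simp: lookup_add algebra_simps single_add)
qed

lemma pa_mult_add_right: "pa_mult Q z (x + y) = pa_mult Q z x + pa_mult Q z y"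
proof -
  let ?A = "Poly_Mapping.keys x \<union> Poly_Mapping.keys y"
  have A: "finite ?A" "Poly_Mapping.keys (x + y) \<subseteq> ?A" by (auto simp: keys_add)
  show ?thesis
    unfolding pa_mult_superset[OF finite_keys subset_refl A]
      pa_mult_superset[OF finite_keys subset_refl A(1) Un_upper1]
      pa_mult_superset[OF finite_keys subset_refl A(1) Un_upper2]
      sum.distrib[symmetric]
    by (intro sum.cong refl) (auto simp: lookup_add algebra_simps single_add)
qed

lemma pa_mult_zero [simp]: "pa_mult Q 0 x = 0" "pa_mult Q x 0 = 0"
  by (simp_all add: pa_mult_def)

lemma pa_mult_sum_left: "pa_mult Q (\<Sum>i\<in>A. f i) z = (\<Sum>i\<in>A. pa_mult Q (f i) z)"
  by (induction A rule: infinite_finite_induct) (simp_all add: pa_mult_add_left)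

lemma pa_mult_sum_right: "pa_mult Q z (\<Sum>i\<in>A. f i) = (\<Sum>i\<in>A. pa_mult Q z (f i))"
  by (induction A rule: infinite_finite_induct) (simp_all add: pa_mult_add_right)

lemma pa_mult_single:
  "pa_mult Q (Poly_Mapping.single p c) (Poly_Mapping.single q d) =
     (if composable Q p q then Poly_Mapping.single (path_comp p q) (c * d) else 0)"
  by (cases "c = 0"; cases "d = 0") (simp_all add: pa_mult_def)

lemma poly_mapping_eq_sum_single:
  "x = (\<Sum>p\<in>Poly_Mapping.keys x. Poly_Mapping.single p (Poly_Mapping.lookup x p))"
  by (rule poly_mapping_eqI)
    (auto simp: lookup_sum lookup_single when_def in_keys_iff sum.delta')

lemma composable_comp_left:
  "composable Q p q \<Longrightarrow> composable Q (path_comp p q) r \<longleftrightarrow> composable Q q r"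
  by (auto simp: composable_def path_target_def path_source_def path_comp_def
      pre_digraph.awalk_verts_conv)

lemma composable_comp_right: "composable Q p (path_comp q r) \<longleftrightarrow> composable Q p q"
  by (simp add: composable_def path_source_def path_comp_def)

lemma path_comp_assoc: "path_comp (path_comp p q) r = path_comp p (path_comp q r)"
  by (simp add: path_comp_def)

lemma pa_mult_assoc: "pa_mult Q (pa_mult Q x y) z = pa_mult Q x (pa_mult Q y z)"
proof -
  let ?s = "\<lambda>x p. Poly_Mapping.single p (Poly_Mapping.lookup x p)"
  have "pa_mult Q (pa_mult Q (?s x p) (?s y q)) (?s z r) =
        pa_mult Q (?s x p) (pa_mult Q (?s y q) (?s z r))" for p q r
    by (auto simp: pa_mult_single composable_comp_left composable_comp_right path_comp_assoc
        mult.assoc)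
  then have "pa_mult Q (pa_mult Q (\<Sum>p\<in>Poly_Mapping.keys x. ?s x p) (\<Sum>q\<in>Poly_Mapping.keys y. ?s y q))
          (\<Sum>r\<in>Poly_Mapping.keys z. ?s z r) =
        pa_mult Q (\<Sum>p\<in>Poly_Mapping.keys x. ?s x p)
          (pa_mult Q (\<Sum>q\<in>Poly_Mapping.keys y. ?s y q) (\<Sum>r\<in>Poly_Mapping.keys z. ?s z r))"
    by (simp only: pa_mult_sum_left pa_mult_sum_right)
  then show ?thesis
    by (simp only: poly_mapping_eq_sum_single[symmetric])
qed

lemma path_comp_in_paths:
  assumes "wf_digraph Q" "p \<in> paths Q" "q \<in> paths Q" "composable Q p q"
  shows "path_comp p q \<in> paths Q"
proof -
  interpret wf_digraph Q by fact
  show ?thesis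
    using assms(2-4) awlast_append[of "fst p" "snd p" "snd q"]
    by (auto simp: paths_def composable_def path_comp_def path_source_def path_target_def
        intro: awalk_appendI)
qed

lemma pa_mult_closed:
  assumes "wf_digraph Q" "Poly_Mapping.keys x \<subseteq> paths Q" "Poly_Mapping.keys y \<subseteq> paths Q"
  shows "Poly_Mapping.keys (pa_mult Q x y) \<subseteq> paths Q"
proof -
  have "path_comp p q \<in> paths Q"
    if "p \<in> Poly_Mapping.keys x" "q \<in> Poly_Mapping.keys y" "composable Q p q" for p q
    using that assms path_comp_in_paths by blast
  then show ?thesis
    unfolding pa_mult_def
    by (intro order_trans[OF keys_sum] UN_least) (simp del: split_paired_All)
qed

lemma trivial_in_paths: "wf_digraph Q \<Longrightarrow> v \<in> verts Q \<Longrightarrow> (v, []) \<in> paths Q"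
  by (simp add: paths_def path_source_def path_target_def wf_digraph.awalk_Nil_iff
      pre_digraph.awalk_verts.simps)

lemma path_ends_in_verts:
  assumes "wf_digraph Q" "p \<in> paths Q"
  shows "path_source p \<in> verts Q" "path_target Q p \<in> verts Q"
  using assms wf_digraph.awlast_in_verts[OF assms(1)]
  by (auto simp: paths_def path_target_def path_source_def pre_digraph.awalk_def)

lemma pa_mult_one:
  assumes "wf_digraph Q" "finite (verts Q)" "Poly_Mapping.keys x \<subseteq> paths Q"
  shows "pa_mult Q (\<Sum>v\<in>verts Q. path_elem (v, [])) x = x"
    and "pa_mult Q x (\<Sum>v\<in>verts Q. path_elem (v, [])) = x"
proof -
  let ?s = "\<lambda>p. Poly_Mapping.single p (Poly_Mapping.lookup x p)"
  have l: "(\<Sum>v\<in>verts Q. pa_mult Q (path_elem (v, [])) (?s p)) = ?s p"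
    if "p \<in> Poly_Mapping.keys x" for p
  proof -
    have "(\<Sum>v\<in>verts Q. pa_mult Q (path_elem (v, [])) (?s p)) =
          (\<Sum>v\<in>verts Q. if v = path_source p then ?s p else 0)"
      by (intro sum.cong refl)
        (auto simp: pa_mult_single composable_def path_target_def path_source_def path_comp_def
          pre_digraph.awalk_verts.simps)
    then show ?thesis
      using assms(2) path_ends_in_verts(1)[OF assms(1) subsetD[OF assms(3) that]] by simp
  qed
  have r: "(\<Sum>v\<in>verts Q. pa_mult Q (?s p) (path_elem (v, []))) = ?s p"
    if "p \<in> Poly_Mapping.keys x" for p
  proof -
    have "(\<Sum>v\<in>verts Q. pa_mult Q (?s p) (path_elem (v, []))) =
          (\<Sum>v\<in>verts Q. if v = path_target Q p then ?s p else 0)"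
      by (intro sum.cong refl)
        (auto simp: pa_mult_single composable_def path_source_def path_comp_def)
    then show ?thesis
      using assms(2) path_ends_in_verts(2)[OF assms(1) subsetD[OF assms(3) that]] by simp
  qed
  have "pa_mult Q (\<Sum>v\<in>verts Q. path_elem (v, [])) (\<Sum>p\<in>Poly_Mapping.keys x. ?s p) =
        (\<Sum>p\<in>Poly_Mapping.keys x. ?s p)"
    unfolding pa_mult_sum_right[of _ _ ?s] pa_mult_sum_left
    by (intro sum.cong refl) (rule l)
  then show "pa_mult Q (\<Sum>v\<in>verts Q. path_elem (v, [])) x = x"
    by (simp only: poly_mapping_eq_sum_single[symmetric])
  have "pa_mult Q (\<Sum>p\<in>Poly_Mapping.keys x. ?s p) (\<Sum>v\<in>verts Q. path_elem (v, [])) =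
        (\<Sum>p\<in>Poly_Mapping.keys x. ?s p)"
    unfolding pa_mult_sum_left[of _ ?s] pa_mult_sum_right
    by (subst sum.swap) (intro sum.cong refl r)
  then show "pa_mult Q x (\<Sum>v\<in>verts Q. path_elem (v, [])) = x"
    by (simp only: poly_mapping_eq_sum_single[symmetric])
qed

lemma ring_path_algebra:
  fixes Q :: "('v, 'e) pre_digraph"
  assumes "wf_digraph Q" "finite (verts Q)"
  shows "ring (path_algebra Q :: (('v, 'e) qpath \<Rightarrow>\<^sub>0 'k::field) ring)"
proof (rule ringI)
  show "abelian_group (path_algebra Q :: (('v, 'e) qpath \<Rightarrow>\<^sub>0 'k::field) ring)"
  proof (rule abelian_groupI, goal_cases)
    case (6 x)
    then show ?case
      by (intro bexI[of _ "- x"]) (auto simp: path_algebra_def in_keys_iff)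
  qed (use keys_add in \<open>fastforce simp: path_algebra_def add_ac\<close>)+
  have "Poly_Mapping.keys (\<Sum>v\<in>verts Q. path_elem (v, []) :: ('v, 'e) qpath \<Rightarrow>\<^sub>0 'k) \<subseteq> paths Q"
    by (intro order_trans[OF keys_sum] UN_least) (auto simp: trivial_in_paths assms)
  then show "monoid (path_algebra Q :: (('v, 'e) qpath \<Rightarrow>\<^sub>0 'k::field) ring)"
    using pa_mult_closed[OF assms(1)] pa_mult_one[OF assms]
    by (intro monoidI) (auto simp: path_algebra_def pa_mult_assoc)
qed (auto simp: path_algebra_def pa_mult_add_left pa_mult_add_right)

end

theory Submission
  imports Defs "HOL-Library.Multiset"
begin

text \<open>
  Well-order the arrows and compare parallel paths by the length-lexicographic order \<open>L\<close>, which is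
  well-founded and compatible with composition. Multiplying an element of \<open>I\<close> by trivial paths
  on both sides cuts out its parallel components, so every nonzero \<open>x \<in> I\<close> involves a tip, that
  is, the leading path of a parallel element of \<open>I\<close>; hence only 0 in \<open>I\<close> is supported on
  non-tips. The tips are closed under multiples. Take the pairs \<open>(s, f)\<close> with \<open>s\<close> a tip minimal
  under divisibility and \<open>f\<close> the unique combination of non-tips congruent to \<open>s\<close> modulo \<open>I\<close>.
  Each basic reduction that is not the identity on \<open>x\<close> replaces one path by \<open>L\<close>-smaller ones, so the
  support of \<open>x\<close> drops in the multiset order. Irreducible means supported on non-tips, and
  reductions preserve residues modulo \<open>I\<close>, whence uniqueness.
\<close>

section \<open>Scalar multiples and two-sided multiplication by paths\<close>

abbreviation smult :: "'k::field \<Rightarrow> ('a \<Rightarrow>\<^sub>0 'k) \<Rightarrow> ('a \<Rightarrow>\<^sub>0 'k)" where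
  "smult c \<equiv> Poly_Mapping.map ((*) c)"

text \<open>With \<open>x = f\<close> this is the product \<open>afc\<close> that a basic reduction
  substitutes for \<open>asc\<close>.\<close>

definition sandwich :: "('v, 'e) pre_digraph \<Rightarrow> ('v, 'e) qpath \<Rightarrow> (('v, 'e) qpath \<Rightarrow>\<^sub>0 'k::field) \<Rightarrow>
    ('v, 'e) qpath \<Rightarrow> (('v, 'e) qpath \<Rightarrow>\<^sub>0 'k)" where
  "sandwich Q a x c = pa_mult Q (pa_mult Q (path_elem a) x) (path_elem c)"

lemma lookup_smult [simp]:
  "Poly_Mapping.lookup (smult c x) p = c * Poly_Mapping.lookup x p"
  by (simp add: map.rep_eq when_def)

lemma keys_smult: "Poly_Mapping.keys (smult c x) \<subseteq> Poly_Mapping.keys x"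
  by (auto simp: in_keys_iff)

lemma smult_zero_left [simp]: "smult 0 x = 0"
  by (rule poly_mapping_eqI) simp

lemma smult_zero_right [simp]: "smult c 0 = 0"
  by (rule poly_mapping_eqI) simp

lemma smult_single [simp]: "smult c (Poly_Mapping.single p d) = Poly_Mapping.single p (c * d)"
  by (rule poly_mapping_eqI) (simp add: lookup_single when_def)

lemma smult_diff: "smult c (x - y) = smult c x - smult c y"
  by (rule poly_mapping_eqI) (simp add: lookup_minus algebra_simps)

lemma smult_sum: "smult c (\<Sum>i\<in>A. f i) = (\<Sum>i\<in>A. smult c (f i))"
  by (rule poly_mapping_eqI) (simp add: lookup_sum sum_distrib_left)

lemma eq_sum_smult_path_elem:
  "x = (\<Sum>p\<in>Poly_Mapping.keys x. smult (Poly_Mapping.lookup x p) (path_elem p))"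
  using poly_mapping_eq_sum_single[of x] by simp

lemma keys_diff_subset:
  "Poly_Mapping.keys (x - y :: 'a \<Rightarrow>\<^sub>0 'k::field) \<subseteq> Poly_Mapping.keys x \<union> Poly_Mapping.keys y"
  by (auto simp: in_keys_iff lookup_minus)

lemma smult_pa_mult: "smult c (pa_mult Q x y) = pa_mult Q (smult c x) y"
proof -
  have "pa_mult Q (smult c x) y = (\<Sum>p\<in>Poly_Mapping.keys x. \<Sum>q\<in>Poly_Mapping.keys y.
        if composable Q p q
        then Poly_Mapping.single (path_comp p q)
          (Poly_Mapping.lookup (smult c x) p * Poly_Mapping.lookup y q)
        else 0)"
    by (rule pa_mult_superset) (auto simp: keys_smult[THEN subsetD])
  then show ?thesis
    by (auto simp: pa_mult_def smult_sum mult.assoc intro!: sum.cong)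
qed

lemma sandwich_eq_sum:
  "sandwich Q a x c =
     (\<Sum>q\<in>Poly_Mapping.keys x. if composable Q a q \<and> composable Q q c
        then Poly_Mapping.single (path_comp (path_comp a q) c) (Poly_Mapping.lookup x q) else 0)"
proof -
  have "sandwich Q a (\<Sum>q\<in>Poly_Mapping.keys x. Poly_Mapping.single q (Poly_Mapping.lookup x q)) c =
     (\<Sum>q\<in>Poly_Mapping.keys x. if composable Q a q \<and> composable Q q c
        then Poly_Mapping.single (path_comp (path_comp a q) c) (Poly_Mapping.lookup x q) else 0)"
    unfolding sandwich_def pa_mult_sum_right pa_mult_sum_left
    by (intro sum.cong refl) (auto simp: pa_mult_single composable_comp_left)
  then show ?thesis
    by (simp only: poly_mapping_eq_sum_single[symmetric])
qed

lemma keys_sandwich: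
  "Poly_Mapping.keys (sandwich Q a x c) \<subseteq>
     {path_comp (path_comp a q) c | q. q \<in> Poly_Mapping.keys x \<and> composable Q a q \<and> composable Q q c}"
  unfolding sandwich_eq_sum
  by (intro order_trans[OF keys_sum] UN_least) (auto simp del: split_paired_Ex split: if_splits)

lemma sandwich_diff: "sandwich Q a (x - y) c = sandwich Q a x c - sandwich Q a y c"
  unfolding eq_diff_eq sandwich_def
  by (simp add: pa_mult_add_left[symmetric] pa_mult_add_right[symmetric])

lemma sandwich_path_elem:
  "composable Q a s \<Longrightarrow> composable Q s c \<Longrightarrow>
     sandwich Q a (path_elem s) c = path_elem (path_comp (path_comp a s) c)"
  by (simp add: sandwich_def pa_mult_path_elem composable_comp_left)

text \<open>Multiplication by trivial paths on both sides projects onto the span of the paths from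
  \<open>v\<close> to \<open>w\<close>, so an ideal contains the parallel components of its
  elements.\<close>

lemma lookup_sandwich_trivial:
  "Poly_Mapping.lookup (sandwich Q (v, []) x (w, [])) p =
     (if path_source p = v \<and> path_target Q p = w then Poly_Mapping.lookup x p else 0)"
proof -
  have "sandwich Q (v, []) x (w, []) = (\<Sum>q\<in>Poly_Mapping.keys x.
      if path_source q = v \<and> path_target Q q = w then Poly_Mapping.single q (Poly_Mapping.lookup x q) else 0)"
    unfolding sandwich_eq_sum
    by (intro sum.cong refl)
      (auto simp: composable_def path_comp_def path_source_def path_target_def pre_digraph.awalk_verts.simps)
  also have "Poly_Mapping.lookup \<dots> p = (\<Sum>q\<in>Poly_Mapping.keys x.
      if q = p then (if path_source p = v \<and> path_target Q p = w then Poly_Mapping.lookup x p else 0) else 0)"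
    unfolding lookup_sum by (intro sum.cong refl) (auto simp: lookup_single)
  finally show ?thesis by (simp add: in_keys_iff)
qed

text \<open>As a correction by a multiple of \<open>afc - asc\<close>, the reduction shows both
  which coefficients can change and that the change lies in the ideal.\<close>

lemma basic_reduction_eq:
  fixes a s c :: "('v, 'e) qpath" and x :: "('v, 'e) qpath \<Rightarrow>\<^sub>0 'k::field"
  defines "t \<equiv> path_comp (path_comp a s) c"
  shows "basic_reduction Q a (s, f) c x =
     x + smult (Poly_Mapping.lookup x t) (sandwich Q a f c - path_elem t)"
proof -
  have "basic_reduction Q a (s, f) c x = (\<Sum>q\<in>Poly_Mapping.keys x.
      Poly_Mapping.single q (Poly_Mapping.lookup x q) +
      (if q = t then smult (Poly_Mapping.lookup x t) (sandwich Q a f c - path_elem t) else 0))"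
    unfolding basic_reduction_def
    by (intro sum.cong refl) (auto simp: sandwich_def t_def smult_diff)
  also have "\<dots> = x + (if t \<in> Poly_Mapping.keys x
      then smult (Poly_Mapping.lookup x t) (sandwich Q a f c - path_elem t) else 0)"
    by (simp add: sum.distrib poly_mapping_eq_sum_single[symmetric])
  finally show ?thesis by (simp add: in_keys_iff)
qed

section \<open>Divisibility of paths\<close>

lemma path_divides_refl:
  assumes "wf_digraph Q" "s \<in> paths Q"
  shows "path_divides Q s s"
  unfolding path_divides_def
  using path_ends_in_verts[OF assms] trivial_in_paths[OF assms(1)]
  by (intro bexI[of _ "(path_source s, [])"] bexI[of _ "(path_target Q s, [])"])
    (auto simp: composable_def path_comp_def path_source_def path_target_def
      pre_digraph.awalk_verts.simps)

lemma path_divides_trans: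
  assumes "wf_digraph Q" "path_divides Q p q" "path_divides Q q t"
  shows "path_divides Q p t"
proof -
  obtain a b where ab: "a \<in> paths Q" "b \<in> paths Q" "composable Q a p" "composable Q p b"
      "q = path_comp (path_comp a p) b"
    using assms(2) unfolding path_divides_def by blast
  obtain c d where cd: "c \<in> paths Q" "d \<in> paths Q" "composable Q c q" "composable Q q d"
      "t = path_comp (path_comp c q) d"
    using assms(3) unfolding path_divides_def by blast
  have "composable Q c a" "composable Q b d"
    using ab cd by (auto simp: composable_comp_left composable_comp_right path_comp_assoc)
  then show ?thesis
    unfolding path_divides_def using ab cd
    by (intro bexI[of _ "path_comp c a"] bexI[of _ "path_comp b d"])
      (auto simp: path_comp_assoc composable_comp_left composable_comp_right
        intro: path_comp_in_paths[OF assms(1)])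
qed

text \<open>Equal lengths force both cofactors to be trivial, and composability then makes the
  sources agree.\<close>

lemma path_divides_length:
  assumes "path_divides Q p q"
  shows "p = q \<or> length (snd p) < length (snd q)"
  using assms
  by (fastforce simp: path_divides_def path_comp_def composable_def path_source_def path_target_def
      pre_digraph.awalk_verts.simps prod_eq_iff)

section \<open>Ideals of the path algebra\<close>

locale path_ideal =
  fixes Q :: "('v, 'e) pre_digraph" and I :: "(('v, 'e) qpath \<Rightarrow>\<^sub>0 'k::field) set"
  assumes wf_Q: "wf_digraph Q"
    and finite_verts: "finite (verts Q)"
    and ideal: "ideal I (path_algebra Q)"
begin

sublocale ideal I "path_algebra Q"
  by (rule ideal)

lemma keys_mem: "x \<in> I \<Longrightarrow> Poly_Mapping.keys x \<subseteq> paths Q"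
  using a_subset by (auto simp: path_algebra_def)

lemma zero_mem: "0 \<in> I"
  using additive_subgroup.zero_closed[OF is_additive_subgroup] by (simp add: path_algebra_def)

lemma add_mem: "x \<in> I \<Longrightarrow> y \<in> I \<Longrightarrow> x + y \<in> I"
  using additive_subgroup.a_closed[OF is_additive_subgroup, of x y] by (simp add: path_algebra_def)

lemma pa_mult_mem_left: "x \<in> I \<Longrightarrow> Poly_Mapping.keys y \<subseteq> paths Q \<Longrightarrow> pa_mult Q y x \<in> I"
  using I_l_closed by (simp add: path_algebra_def)

lemma pa_mult_mem_right: "x \<in> I \<Longrightarrow> Poly_Mapping.keys y \<subseteq> paths Q \<Longrightarrow> pa_mult Q x y \<in> I"
  using I_r_closed by (simp add: path_algebra_def)

text \<open>Ideals absorb elements of the algebra, so the scalar is realised as the multiple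
  \<open>c\<close> of the unit; finitely many vertices make the sum of trivial paths a unit.\<close>

lemma smult_mem:
  assumes "x \<in> I"
  shows "smult c x \<in> I"
proof -
  let ?e = "\<Sum>v\<in>verts Q. path_elem (v, [])"
  have "Poly_Mapping.keys (smult c ?e) \<subseteq> paths Q"
    by (intro order_trans[OF keys_smult] order_trans[OF keys_sum] UN_least)
      (auto simp: trivial_in_paths wf_Q)
  from pa_mult_mem_left[OF assms this] show ?thesis
    using pa_mult_one(1)[OF wf_Q finite_verts keys_mem[OF assms]]
    by (simp add: smult_pa_mult[symmetric])
qed

lemma diff_mem:
  assumes "x \<in> I" "y \<in> I"
  shows "x - y \<in> I"
proof -
  have "smult (-1) y = - y" by (rule poly_mapping_eqI) simp
  then show ?thesis using add_mem[OF assms(1) smult_mem[OF assms(2), of "-1"]] by simp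
qed

lemma sum_mem: "(\<And>i. i \<in> A \<Longrightarrow> f i \<in> I) \<Longrightarrow> (\<Sum>i\<in>A. f i) \<in> I"
  by (induction A rule: infinite_finite_induct) (auto simp: zero_mem add_mem)

lemma sandwich_mem: "x \<in> I \<Longrightarrow> a \<in> paths Q \<Longrightarrow> c \<in> paths Q \<Longrightarrow> sandwich Q a x c \<in> I"
  by (simp add: sandwich_def pa_mult_mem_left pa_mult_mem_right)

text \<open>Representatives of single paths are combined linearly. The sets \<open>P q\<close>
  record what is known about their supports.\<close>

lemma linear_representative:
  assumes "\<And>q. q \<in> Poly_Mapping.keys x \<Longrightarrow> \<exists>h. path_elem q - h \<in> I \<and> Poly_Mapping.keys h \<subseteq> P q"
  shows "\<exists>h. x - h \<in> I \<and> Poly_Mapping.keys h \<subseteq> (\<Union>q\<in>Poly_Mapping.keys x. P q)"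
proof -
  obtain h where h: "\<And>q. q \<in> Poly_Mapping.keys x \<Longrightarrow>
      path_elem q - h q \<in> I \<and> Poly_Mapping.keys (h q) \<subseteq> P q"
    using assms by metis
  let ?c = "Poly_Mapping.lookup x"
  have "x - (\<Sum>q\<in>Poly_Mapping.keys x. smult (?c q) (h q)) =
      (\<Sum>q\<in>Poly_Mapping.keys x. smult (?c q) (path_elem q - h q))"
    unfolding smult_diff sum_subtractf eq_sum_smult_path_elem[symmetric] ..
  also have "\<dots> \<in> I" using h by (intro sum_mem smult_mem) blast
  finally show ?thesis
    using h keys_smult
    by (intro exI[of _ "\<Sum>q\<in>Poly_Mapping.keys x. smult (?c q) (h q)"] conjI
        order_trans[OF keys_sum]) fastforce+
qed

end

section \<open>Admissible orders\<close>

text \<open>Only parallel paths are compared, so anything supported below \<open>s\<close> is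
  parallel to \<open>s\<close>. Totality within parallel classes suffices, since ideals can be
  studied through parallel components.\<close>

locale path_order =
  fixes Q :: "('v, 'e) pre_digraph" and L :: "('v, 'e) qpath rel"
  assumes wf_L: "wf L"
    and L_paths: "(p, q) \<in> L \<Longrightarrow> p \<in> paths Q \<and> q \<in> paths Q"
    and L_parallel: "(p, q) \<in> L \<Longrightarrow> path_source p = path_source q \<and> path_target Q p = path_target Q q"
    and L_trans: "trans L"
    and L_total: "p \<in> paths Q \<Longrightarrow> q \<in> paths Q \<Longrightarrow> path_source p = path_source q \<Longrightarrow>
        path_target Q p = path_target Q q \<Longrightarrow> p = q \<or> (p, q) \<in> L \<or> (q, p) \<in> L"
    and L_path_comp: "(p, q) \<in> L \<Longrightarrow> a \<in> paths Q \<Longrightarrow> c \<in> paths Q \<Longrightarrow> composable Q a q \<Longrightarrow>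
        composable Q q c \<Longrightarrow> (path_comp (path_comp a p) c, path_comp (path_comp a q) c) \<in> L"
begin

lemma L_irrefl: "(p, p) \<notin> L"
  using wf_L by (rule wf_not_refl)

lemma keys_sandwich_less:
  assumes "\<forall>q\<in>Poly_Mapping.keys f. (q, s) \<in> L"
    and "a \<in> paths Q" "c \<in> paths Q" "composable Q a s" "composable Q s c"
  shows "\<forall>q\<in>Poly_Mapping.keys (sandwich Q a f c). (q, path_comp (path_comp a s) c) \<in> L"
proof
  fix p assume "p \<in> Poly_Mapping.keys (sandwich Q a f c)"
  with keys_sandwich obtain q where "q \<in> Poly_Mapping.keys f" "p = path_comp (path_comp a q) c"
    by blast
  then show "(p, path_comp (path_comp a s) c) \<in> L"
    using assms by (simp add: L_path_comp)
qed

text \<open>A nontrivial step removes \<open>asc\<close> from the support and adds only paths of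
  \<open>afc\<close>, all of them below \<open>asc\<close>: a descent in the multiset extension of
  \<open>L\<close>.\<close>

lemma basic_reduction_decreasing:
  fixes x :: "('v, 'e) qpath \<Rightarrow>\<^sub>0 'k::field"
  assumes f: "\<forall>q\<in>Poly_Mapping.keys f. (q, s) \<in> L"
    and ac: "a \<in> paths Q" "c \<in> paths Q" "composable Q a s" "composable Q s c"
    and neq: "basic_reduction Q a (s, f) c x \<noteq> x"
  shows "(mset_set (Poly_Mapping.keys (basic_reduction Q a (s, f) c x)),
          mset_set (Poly_Mapping.keys x)) \<in> mult L"
proof -
  let ?t = "path_comp (path_comp a s) c"
  let ?y = "basic_reduction Q a (s, f) c x"
  let ?X = "Poly_Mapping.keys x" and ?Y = "Poly_Mapping.keys ?y"
  have y: "?y = x + smult (Poly_Mapping.lookup x ?t) (sandwich Q a f c - path_elem ?t)"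
    by (rule basic_reduction_eq)
  have less: "\<forall>q\<in>Poly_Mapping.keys (sandwich Q a f c). (q, ?t) \<in> L"
    using f ac by (rule keys_sandwich_less)
  then have "?t \<notin> Poly_Mapping.keys (sandwich Q a f c)"
    using L_irrefl[of ?t] by metis
  then have "?t \<notin> ?Y"
    by (simp add: y in_keys_iff lookup_add lookup_minus)
  moreover have "?t \<in> ?X"
  proof (rule ccontr)
    assume "?t \<notin> ?X"
    then have "?y = x" by (simp add: y in_keys_iff)
    with neq show False ..
  qed
  ultimately have t: "?t \<in># mset_set (?X - ?Y)" by simp
  have "q \<in> Poly_Mapping.keys (sandwich Q a f c)" if "q \<in> ?Y - ?X" for q
    using that by (auto simp: y in_keys_iff lookup_add lookup_minus lookup_single when_def split: if_splits)
  \<comment> \<open>The single removed path \<open>?t\<close> dominates every path that is new in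
    the support.\<close>
  then have "\<forall>k\<in>#mset_set (?Y - ?X). \<exists>j\<in>#mset_set (?X - ?Y). (k, j) \<in> L"
    using t less \<open>\<And>q. q \<in> ?Y - ?X \<Longrightarrow> q \<in> Poly_Mapping.keys (sandwich Q a f c)\<close>
    by (metis finite_Diff finite_keys finite_set_mset_mset_set)
  moreover have "mset_set (?X - ?Y) \<noteq> {#}"
    using t by (metis empty_not_add_mset multi_member_split)
  ultimately have "(mset_set (?X \<inter> ?Y) + mset_set (?Y - ?X), mset_set (?X \<inter> ?Y) + mset_set (?X - ?Y)) \<in> mult L"
    by (intro one_step_implies_mult)
  moreover have "mset_set (?X \<inter> ?Y) + mset_set (?Y - ?X) = mset_set ?Y"
    "mset_set (?X \<inter> ?Y) + mset_set (?X - ?Y) = mset_set ?X"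
    using mset_set_Union[of "?X \<inter> ?Y" "?Y - ?X"] mset_set_Union[of "?X \<inter> ?Y" "?X - ?Y"]
      Int_Diff_Un[of ?X ?Y] Int_Diff_Un[of ?Y ?X]
    by (simp_all add: Int_commute[of ?Y ?X] disjoint_iff)
  ultimately show ?thesis by simp
qed

lemma reduction_finiteI:
  fixes R :: "('v, 'e, 'k::field) red_sys"
  assumes R: "\<And>s f. (s, f) \<in> R \<Longrightarrow> \<forall>q\<in>Poly_Mapping.keys f. (q, s) \<in> L"
  shows "reduction_finite Q R p"
  unfolding reduction_finite_def
proof (intro allI impI)
  fix r :: "nat \<Rightarrow> (('v, 'e) qpath \<Rightarrow>\<^sub>0 'k) \<Rightarrow> (('v, 'e) qpath \<Rightarrow>\<^sub>0 'k)"
  assume r: "\<forall>i. r i \<in> basic_reductions Q R"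
  let ?x = "\<lambda>n. apply_seq r n (path_elem p)"
  let ?m = "\<lambda>n. mset_set (Poly_Mapping.keys (?x n))"
  have "wf (inv_image (mult L) ?m)"
    using wf_L by (intro wf_inv_image wf_mult)
  \<comment> \<open>At stage \<open>N\<close> the support is minimal in the multiset order, so every
    later step must act as the identity.\<close>
  then obtain N where N: "\<And>n. (?m n, ?m N) \<notin> mult L"
    using wf_eq_minimal[THEN iffD1, rule_format, of "inv_image (mult L) ?m" 0 UNIV] by auto
  have "?x n = ?x N" if "n \<ge> N" for n
    using that
  proof (induction n rule: dec_induct)
    case (step n)
    from r obtain a s f c where "r n = basic_reduction Q a (s, f) c" "(s, f) \<in> R" "a \<in> paths Q"
        "c \<in> paths Q" "composable Q a s" "composable Q s c"
      unfolding basic_reductions_def by blast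
    with basic_reduction_decreasing[OF R, of s f a c "?x n"] N[of "Suc n"] step.IH
    show ?case by auto
  qed simp
  then show "\<exists>N. \<forall>n\<ge>N. ?x n = ?x N" by blast
qed

end

section \<open>Tips of an ideal\<close>

locale ordered_path_ideal = path_order Q L + path_ideal Q I
  for Q :: "('v, 'e) pre_digraph" and L and I :: "(('v, 'e) qpath \<Rightarrow>\<^sub>0 'k::field) set"
begin

text \<open>Leading paths of parallel elements of \<open>I\<close>, with the leading coefficient
  normalised to 1.\<close>

definition tips :: "('v, 'e) qpath set" where
  "tips = {s \<in> paths Q. \<exists>g. path_elem s - g \<in> I \<and> (\<forall>q\<in>Poly_Mapping.keys g. (q, s) \<in> L)}"

lemma tips_subset: "tips \<subseteq> paths Q"
  unfolding tips_def by blast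

definition minimal_tips :: "('v, 'e) qpath set" where
  "minimal_tips = {s \<in> tips. \<forall>s'\<in>tips. path_divides Q s' s \<longrightarrow> s' = s}"

text \<open>If \<open>s - g\<close> witnesses the tip \<open>s\<close>, then
  \<open>asc - agc\<close> witnesses \<open>asc\<close>, because composition preserves
  \<open>L\<close>.\<close>

lemma tips_multiple:
  assumes "s \<in> tips" "path_divides Q s t"
  shows "t \<in> tips"
proof -
  obtain g where g: "path_elem s - g \<in> I" "\<forall>q\<in>Poly_Mapping.keys g. (q, s) \<in> L" and s: "s \<in> paths Q"
    using assms(1) unfolding tips_def by blast
  obtain a c where ac: "a \<in> paths Q" "c \<in> paths Q" "composable Q a s" "composable Q s c"
      and t: "t = path_comp (path_comp a s) c"
    using assms(2) unfolding path_divides_def by blast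
  have "t \<in> paths Q"
    using ac s unfolding t by (intro path_comp_in_paths wf_Q)
      (auto simp: composable_comp_left)
  moreover have "path_elem t - sandwich Q a g c \<in> I"
    using sandwich_mem[OF g(1) ac(1,2)] ac(3,4) by (simp add: sandwich_diff sandwich_path_elem t)
  ultimately show ?thesis
    unfolding tips_def using keys_sandwich_less[OF g(2) ac] t by blast
qed

text \<open>A tip that is not minimal has a strictly shorter tip as a divisor, so induction on the
  length applies.\<close>

lemma minimal_tip_divides:
  assumes "t \<in> tips"
  shows "\<exists>s\<in>minimal_tips. path_divides Q s t"
  using assms
proof (induction "length (snd t)" arbitrary: t rule: less_induct)
  case less
  show ?case
  proof (cases "t \<in> minimal_tips")
    case True
    then show ?thesis using path_divides_refl[OF wf_Q, of t] less.prems unfolding tips_def by blast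
  next
    case False
    then obtain s where s: "s \<in> tips" "path_divides Q s t" "s \<noteq> t"
      using less.prems unfolding minimal_tips_def by blast
    then have "length (snd s) < length (snd t)" using path_divides_length by blast
    with less.hyps s show ?thesis using path_divides_trans[OF wf_Q] by blast
  qed
qed

lemma nonzero_has_tip:
  assumes "x \<in> I" "x \<noteq> 0"
  shows "\<exists>s\<in>Poly_Mapping.keys x. s \<in> tips"
proof -
  obtain p where p: "p \<in> Poly_Mapping.keys x"
    using assms(2) by (metis in_keys_iff lookup_zero poly_mapping_eqI)
  then have pp: "p \<in> paths Q" using keys_mem assms(1) by blast
  define y where "y = sandwich Q (path_source p, []) x (path_target Q p, [])"
  have lookup_y: "Poly_Mapping.lookup y q =
      (if path_source q = path_source p \<and> path_target Q q = path_target Q p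
       then Poly_Mapping.lookup x q else 0)" for q
    unfolding y_def by (rule lookup_sandwich_trivial)
  have "y \<in> I"
    unfolding y_def using assms(1) path_ends_in_verts[OF wf_Q pp]
    by (intro sandwich_mem trivial_in_paths wf_Q)
  \<comment> \<open>A largest path is wanted, while \<open>wf L\<close> provides smallest ones.
    Finiteness of the support makes the converse relation well-founded too.\<close>
  have "wf ((L \<inter> Poly_Mapping.keys y \<times> Poly_Mapping.keys y)\<inverse>)"
    by (intro finite_acyclic_wf_converse finite_Int disjI2 finite_cartesian_product finite_keys
        acyclic_subset[OF wf_acyclic[OF wf_L]]) auto
  moreover have "p \<in> Poly_Mapping.keys y" using p by (simp add: in_keys_iff lookup_y)
  ultimately obtain s where s: "s \<in> Poly_Mapping.keys y"
    and max: "\<And>q. q \<in> Poly_Mapping.keys y \<Longrightarrow> (s, q) \<notin> L"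
    unfolding wf_eq_minimal by (metis (no_types, lifting) IntI converse_iff mem_Sigma_iff)
  have below: "(q, s) \<in> L" if "q \<in> Poly_Mapping.keys y" "q \<noteq> s" for q
    using that s max[OF that(1)] L_total[of q s] subsetD[OF keys_mem[OF \<open>y \<in> I\<close>]]
    by (auto simp: in_keys_iff lookup_y split: if_splits)
  define c where "c = inverse (Poly_Mapping.lookup y s)"
  \<comment> \<open>Scaling by \<open>c\<close> gives \<open>s\<close> coefficient 1, so
    \<open>s\<close> cancels and only smaller paths remain in the witness.\<close>
  have "\<forall>q\<in>Poly_Mapping.keys (path_elem s - smult c y). (q, s) \<in> L"
  proof
    fix q assume q: "q \<in> Poly_Mapping.keys (path_elem s - smult c y)"
    then have "q \<noteq> s" using s by (auto simp: in_keys_iff lookup_minus c_def)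
    with q show "(q, s) \<in> L"
      by (intro below) (auto simp: in_keys_iff lookup_minus lookup_single)
  qed
  moreover have "path_elem s - (path_elem s - smult c y) \<in> I"
    using smult_mem[OF \<open>y \<in> I\<close>] by simp
  moreover have "s \<in> Poly_Mapping.keys x" using s by (auto simp: in_keys_iff lookup_y split: if_splits)
  ultimately show ?thesis
    unfolding tips_def using keys_mem assms(1) by blast
qed

text \<open>Linear independence of the non-tips modulo \<open>I\<close>, on which all the uniqueness
  arguments rest.\<close>

lemma eq_0_if_no_tips:
  "x \<in> I \<Longrightarrow> Poly_Mapping.keys x \<inter> tips = {} \<Longrightarrow> x = 0"
  using nonzero_has_tip by blast

text \<open>The ideal \<open>J\<close> is \<open>I\<close> itself when the normal forms are constructed, and later the ideal
  generated by the reduction system.\<close>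

lemma normal_form_path:
  assumes J: "path_ideal Q J"
    and tip: "\<And>s. s \<in> tips \<Longrightarrow> \<exists>g. path_elem s - g \<in> J \<and> (\<forall>q\<in>Poly_Mapping.keys g. (q, s) \<in> L)"
    and "p \<in> paths Q"
  shows "\<exists>g. path_elem p - g \<in> J \<and> Poly_Mapping.keys g \<subseteq> {q. q \<notin> tips \<and> (q = p \<or> (q, p) \<in> L)}"
  using wf_L assms(3)
proof (induction p rule: wf_induct_rule)
  case (less p)
  interpret J: path_ideal Q J by (rule J)
  show ?case
  proof (cases "p \<in> tips")
    case False
    then show ?thesis using J.zero_mem by (intro exI[of _ "path_elem p"]) auto
  next
    case True
    from tip[OF this] obtain g where g: "path_elem p - g \<in> J" "\<forall>q\<in>Poly_Mapping.keys g. (q, p) \<in> L"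
      by blast
    \<comment> \<open>All paths of \<open>g\<close> lie below \<open>p\<close>, so the induction
      hypothesis gives them normal forms, to be combined linearly.\<close>
    have "\<exists>h. path_elem q - h \<in> J \<and> Poly_Mapping.keys h \<subseteq> {u. u \<notin> tips \<and> (u = q \<or> (u, q) \<in> L)}"
      if "q \<in> Poly_Mapping.keys g" for q
      using less.IH[of q] g(2) that L_paths by blast
    from J.linear_representative[of g, OF this] obtain h where h: "g - h \<in> J"
        "Poly_Mapping.keys h \<subseteq> (\<Union>q\<in>Poly_Mapping.keys g. {u. u \<notin> tips \<and> (u = q \<or> (u, q) \<in> L)})"
      by blast
    have "path_elem p - h \<in> J" using J.add_mem[OF g(1) h(1)] by simp
    moreover have "Poly_Mapping.keys h \<subseteq> {q. q \<notin> tips \<and> (q = p \<or> (q, p) \<in> L)}"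
      using h(2) g(2) transD[OF L_trans] by blast
    ultimately show ?thesis by blast
  qed
qed

section \<open>The reduction system on the minimal tips\<close>

definition red_sys :: "('v, 'e, 'k) red_sys" where
  "red_sys = {(s, f). s \<in> minimal_tips \<and> path_elem s - f \<in> I \<and>
     (\<forall>q\<in>Poly_Mapping.keys f. (q, s) \<in> L \<and> q \<notin> tips)}"

lemma red_sysD:
  assumes "(s, f) \<in> red_sys"
  shows "s \<in> minimal_tips" "s \<in> tips" "s \<in> paths Q" "path_elem s - f \<in> I"
    "\<forall>q\<in>Poly_Mapping.keys f. (q, s) \<in> L" "Poly_Mapping.keys f \<inter> tips = {}"
  using assms tips_subset by (auto simp: red_sys_def minimal_tips_def)

text \<open>The normal form of \<open>s\<close> serves as \<open>f\<close>; it cannot involve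
  \<open>s\<close>, which is a tip. With \<open>red_sys_unique\<close>, \<open>red_sys\<close> is
  the graph of a function on the minimal tips.\<close>

lemma red_sys_exists:
  assumes "s \<in> minimal_tips"
  shows "\<exists>f. (s, f) \<in> red_sys"
proof -
  have s: "s \<in> tips" "s \<in> paths Q" using assms by (auto simp: minimal_tips_def tips_def)
  then obtain f where "path_elem s - f \<in> I"
      "Poly_Mapping.keys f \<subseteq> {q. q \<notin> tips \<and> (q = s \<or> (q, s) \<in> L)}"
    using normal_form_path[OF path_ideal_axioms, of s] unfolding tips_def by blast
  then show ?thesis using assms s by (auto simp: red_sys_def)
qed

text \<open>Two candidates differ by an element of \<open>I\<close> supported on non-tips.\<close>

lemma red_sys_unique:
  assumes "(s, f) \<in> red_sys" "(s, g) \<in> red_sys"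
  shows "f = g"
proof -
  have "g - f \<in> I"
    using diff_mem[OF red_sysD(4)[OF assms(1)] red_sysD(4)[OF assms(2)]] by simp
  moreover have "Poly_Mapping.keys (g - f) \<inter> tips = {}"
    using assms[THEN red_sysD(6)] keys_diff_subset[of g f] by blast
  ultimately show ?thesis using eq_0_if_no_tips by fastforce
qed

lemma reduction_system_red_sys: "reduction_system Q red_sys"
proof -
  have "s \<in> paths Q \<and> f \<in> carrier (path_algebra Q) \<and> parallel Q f s \<and> f \<noteq> path_elem s"
    if sf: "(s, f) \<in> red_sys" for s f
  proof -
    have "f \<noteq> path_elem s" using L_irrefl[of s] red_sysD(5)[OF sf] by auto
    moreover have "parallel Q f s" "Poly_Mapping.keys f \<subseteq> paths Q"
      using red_sysD(5)[OF sf] L_paths L_parallel unfolding parallel_def by blast+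
    ultimately show ?thesis using red_sysD(3)[OF sf] by (simp add: path_algebra_def)
  qed
  \<comment> \<open>Minimality would turn divisibility into \<open>s = s'\<close>, and
    \<open>red_sys_unique\<close> would then identify the pairs.\<close>
  moreover have "\<not> path_divides Q s s'"
    if "(s, f) \<in> red_sys" "(s', f') \<in> red_sys" "(s, f) \<noteq> (s', f')" for s f s' f'
    using that red_sys_unique red_sysD(1,2) unfolding minimal_tips_def by blast
  ultimately show ?thesis unfolding reduction_system_def by blast
qed

section \<open>Irreducible elements and reduction-uniqueness\<close>

lemma tip_reducible:
  assumes "t \<in> tips"
  obtains a s f c where "(s, f) \<in> red_sys" "a \<in> paths Q" "c \<in> paths Q" "composable Q a s"
    "composable Q s c" "t = path_comp (path_comp a s) c"
  using minimal_tip_divides[OF assms] red_sys_exists unfolding path_divides_def by blast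

text \<open>A tip in the support is some \<open>asc\<close>, and the corresponding reduction removes
  it. Conversely every \<open>asc\<close> is a tip, so an element without tips is fixed.\<close>

lemma red_irreducible_iff:
  "red_irreducible Q red_sys x \<longleftrightarrow> Poly_Mapping.keys x \<inter> tips = {}"
proof
  assume irr: "red_irreducible Q red_sys x"
  show "Poly_Mapping.keys x \<inter> tips = {}"
  proof (rule ccontr)
    assume "Poly_Mapping.keys x \<inter> tips \<noteq> {}"
    then obtain t where t: "t \<in> Poly_Mapping.keys x" "t \<in> tips" by blast
    from t(2) obtain a s f c where ac: "(s, f) \<in> red_sys" "a \<in> paths Q" "c \<in> paths Q" "composable Q a s"
      "composable Q s c" "t = path_comp (path_comp a s) c" by (rule tip_reducible)
    have "basic_reduction Q a (s, f) c \<in> basic_reductions Q red_sys"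
      unfolding basic_reductions_def using ac by blast
    then have "basic_reduction Q a (s, f) c x = x"
      using irr by (simp add: red_irreducible_def)
    then have "smult (Poly_Mapping.lookup x t) (sandwich Q a f c - path_elem t) = 0"
      using ac(6) by (simp add: basic_reduction_eq)
    \<comment> \<open>Unless \<open>t\<close> occurs in \<open>afc\<close>, this coefficient is
      minus the nonzero coefficient of \<open>t\<close> in \<open>x\<close>.\<close>
    then have "Poly_Mapping.lookup (smult (Poly_Mapping.lookup x t) (sandwich Q a f c - path_elem t)) t = 0"
      by simp
    then have "t \<in> Poly_Mapping.keys (sandwich Q a f c)"
      using t(1) by (auto simp: in_keys_iff lookup_minus)
    moreover have "\<forall>q\<in>Poly_Mapping.keys (sandwich Q a f c). (q, t) \<in> L"
      unfolding ac(6) by (rule keys_sandwich_less[OF red_sysD(5)[OF ac(1)] ac(2-5)])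
    ultimately show False using L_irrefl by blast
  qed
next
  assume keys: "Poly_Mapping.keys x \<inter> tips = {}"
  show "red_irreducible Q red_sys x"
    unfolding red_irreducible_def
  proof
    fix r :: "(('v, 'e) qpath \<Rightarrow>\<^sub>0 'k) \<Rightarrow> (('v, 'e) qpath \<Rightarrow>\<^sub>0 'k)"
    assume "r \<in> basic_reductions Q red_sys"
    then obtain a s f c where r: "r = basic_reduction Q a (s, f) c" and
      ac: "(s, f) \<in> red_sys" "a \<in> paths Q" "c \<in> paths Q" "composable Q a s" "composable Q s c"
      unfolding basic_reductions_def by blast
    have "path_divides Q s (path_comp (path_comp a s) c)" using ac by (auto simp: path_divides_def)
    with red_sysD(2)[OF ac(1)] have "path_comp (path_comp a s) c \<in> tips" by (rule tips_multiple)
    with keys have "Poly_Mapping.lookup x (path_comp (path_comp a s) c) = 0"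
      by (auto simp: in_keys_iff)
    then show "r x = x" by (simp add: r basic_reduction_eq)
  qed
qed

text \<open>Each basic reduction adds a multiple of \<open>a(f - s)c\<close>, and these changes sum
  up along the sequence.\<close>

lemma reduction_diff_mem:
  assumes "r \<in> reductions Q red_sys"
  shows "r x - x \<in> I"
proof -
  have basic: "b y - y \<in> I" if b: "b \<in> basic_reductions Q red_sys" for b y
  proof -
    from b obtain a s f c where b: "b = basic_reduction Q a (s, f) c" and
      ac: "(s, f) \<in> red_sys" "a \<in> paths Q" "c \<in> paths Q" "composable Q a s" "composable Q s c"
      unfolding basic_reductions_def by blast
    have "sandwich Q a (path_elem s - f) c \<in> I"
      using ac by (intro sandwich_mem red_sysD(4))
    from diff_mem[OF zero_mem this]
    have "sandwich Q a f c - path_elem (path_comp (path_comp a s) c) \<in> I"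
      using ac by (simp add: sandwich_diff sandwich_path_elem)
    then show ?thesis by (simp add: b basic_reduction_eq smult_mem)
  qed
  have "foldr (\<circ>) rs id x - x \<in> I" if "set rs \<subseteq> basic_reductions Q red_sys" for rs
    using that
  proof (induction rs)
    case (Cons b rs)
    let ?y = "foldr (\<circ>) rs id x"
    have "b ?y - ?y \<in> I" using Cons.prems by (intro basic) simp
    moreover have "?y - x \<in> I" using Cons.prems by (intro Cons.IH) simp
    ultimately have "b ?y - x \<in> I" using add_mem by fastforce
    moreover have "foldr (\<circ>) (b # rs) id x = b ?y" by simp
    ultimately show ?case by metis
  qed (simp add: zero_mem)
  then show ?thesis using assms unfolding reductions_def by blast
qed

text \<open>Two irreducible results are both congruent to \<open>p\<close> modulo \<open>I\<close>,
  so their difference lies in \<open>I\<close> and avoids the tips.\<close>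

lemma reduction_unique_red_sys: "reduction_unique Q red_sys p"
  unfolding reduction_unique_def
proof (intro conjI ballI impI)
  show "reduction_finite Q red_sys p"
    by (rule reduction_finiteI) (rule red_sysD(5))
next
  fix r r' assume "r \<in> reductions Q red_sys" "r' \<in> reductions Q red_sys"
    "red_irreducible Q red_sys (r (path_elem p)) \<and> red_irreducible Q red_sys (r' (path_elem p))"
  then have "r (path_elem p) - r' (path_elem p) \<in> I"
    "Poly_Mapping.keys (r (path_elem p) - r' (path_elem p)) \<inter> tips = {}"
    using diff_mem[OF reduction_diff_mem[of r "path_elem p"] reduction_diff_mem[of r' "path_elem p"]]
      keys_diff_subset[of "r (path_elem p)" "r' (path_elem p)"]
    by (auto simp: red_irreducible_iff)
  then show "r (path_elem p) = r' (path_elem p)" using eq_0_if_no_tips by fastforce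
qed

section \<open>Generation of the ideal\<close>

lemma genideal_red_sys: "I = genideal (path_algebra Q) {path_elem s - f | s f. (s, f) \<in> red_sys}"
    (is "I = genideal _ ?G")
proof
  have G: "?G \<subseteq> I" by (auto simp: red_sys_def)
  show "genideal (path_algebra Q) ?G \<subseteq> I"
    by (rule genideal_minimal[OF ideal G])
  let ?J = "genideal (path_algebra Q) ?G"
  have "path_ideal Q ?J"
    by (intro path_ideal.intro wf_Q finite_verts genideal_ideal[OF order_trans[OF G a_subset]])
  then interpret J: path_ideal Q ?J .
  have GJ: "?G \<subseteq> ?J" by (rule genideal_self[OF order_trans[OF G a_subset]])
  \<comment> \<open>For normal forms modulo \<open>?J\<close>, every tip needs a smaller
    representative; multiplying the generator of a minimal tip dividing \<open>t\<close> supplies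
    it.\<close>
  have "\<exists>g. path_elem t - g \<in> ?J \<and> (\<forall>q\<in>Poly_Mapping.keys g. (q, t) \<in> L)" if "t \<in> tips" for t
  proof -
    from that obtain a s f c where ac: "(s, f) \<in> red_sys" "a \<in> paths Q" "c \<in> paths Q" "composable Q a s"
      "composable Q s c" "t = path_comp (path_comp a s) c" by (rule tip_reducible)
    have "sandwich Q a (path_elem s - f) c \<in> ?J"
      using ac by (intro J.sandwich_mem subsetD[OF GJ]) blast+
    then have "path_elem t - sandwich Q a f c \<in> ?J"
      using ac by (simp add: sandwich_diff sandwich_path_elem)
    moreover have "\<forall>q\<in>Poly_Mapping.keys (sandwich Q a f c). (q, t) \<in> L"
      unfolding ac(6) by (rule keys_sandwich_less[OF red_sysD(5)[OF ac(1)] ac(2-5)])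
    ultimately show ?thesis by blast
  qed
  note nf = normal_form_path[OF J.path_ideal_axioms this]
  show "I \<subseteq> ?J"
  proof
    fix x assume x: "x \<in> I"
    have "\<exists>h. path_elem q - h \<in> ?J \<and> Poly_Mapping.keys h \<subseteq> - tips"
      if "q \<in> Poly_Mapping.keys x" for q
      using nf[of q] keys_mem[OF x] that by blast
    from J.linear_representative[of x, OF this] obtain h
      where h: "x - h \<in> ?J" "Poly_Mapping.keys h \<subseteq> (\<Union>q\<in>Poly_Mapping.keys x. - tips)" by blast
    \<comment> \<open>Since \<open>?J\<close> is contained in \<open>I\<close>, the normal form
      \<open>h\<close> of \<open>x\<close> lies in \<open>I\<close>; being free of tips, it
      vanishes.\<close>
    have "x - h \<in> I" using h(1) genideal_minimal[OF ideal G] by blast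
    then have "h \<in> I" using diff_mem[OF x, of "x - h"] by simp
    then have "h = 0" using h(2) eq_0_if_no_tips by blast
    then show "x \<in> ?J" using h(1) by simp
  qed
qed

lemma diamond_condition_red_sys: "diamond_condition Q red_sys I"
  unfolding diamond_condition_def
proof (intro conjI ballI genideal_red_sys reduction_unique_red_sys; clarify)
  fix s f assume "(s, f) \<in> red_sys"
  then show "red_irreducible Q red_sys f" by (simp add: red_irreducible_iff red_sysD(6))
qed

end

section \<open>Existence of an admissible order\<close>

text \<open>Comparing lengths first is essential: lexicographically \<open>[]\<close> precedes
  \<open>[b]\<close>, yet \<open>[c]\<close> follows \<open>[b, c]\<close> when \<open>b\<close>
  precedes \<open>c\<close>.\<close>

lemma lenlex_append_both:
  assumes "irrefl r" "(us, vs) \<in> lenlex r"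
  shows "(xs @ us @ ys, xs @ vs @ ys) \<in> lenlex r"
  using lenlex_append1[OF assms(2), of ys ys] assms(1) by simp

text \<open>There may be infinitely many arrows, so they are well-ordered first; the
  length-lexicographic order then inherits well-foundedness.\<close>

lemma ex_path_order:
  assumes "wf_digraph (Q :: ('v, 'e) pre_digraph)"
  shows "\<exists>L. path_order Q L"
proof -
  obtain r0 :: "'e rel" where wo: "well_order_on UNIV r0"
    using well_order_on[of UNIV] by (rule exE)
  then have r0: "trans r0" "antisym r0" "total r0" "wf (r0 - Id)"
    unfolding well_order_on_def linear_order_on_def partial_order_on_def preorder_on_def
    by blast+
  define r where "r = r0 - Id"
  have wf: "wf r" and trans: "trans r" and total: "total r" and irrefl: "irrefl r"
    unfolding r_def using r0(4) trans_diff_Id[OF r0(1,2)] r0(3) wf_not_refl[OF r0(4)]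
    by (auto simp only: total_on_diff_Id irrefl_def)
  define L where "L = {(p, q). p \<in> paths Q \<and> q \<in> paths Q \<and> path_source p = path_source q \<and>
      path_target Q p = path_target Q q \<and> (snd p, snd q) \<in> lenlex r}"
  have "path_order Q L"
  proof
    have "L \<subseteq> inv_image (lenlex r) snd" by (auto simp: L_def)
    then show "wf L" by (rule wf_subset[rotated]) (intro wf_inv_image wf_lenlex wf)
    show "trans L"
      by (rule transI) (auto simp: L_def intro: lenlex_trans[OF _ _ trans])
  next
    fix p q :: "('v, 'e) qpath"
    assume "p \<in> paths Q" "q \<in> paths Q" "path_source p = path_source q" "path_target Q p = path_target Q q"
    \<comment> \<open>Equal arrow lists give equal paths here, because the sources agree.\<close>
    moreover have "snd p = snd q \<or> (snd p, snd q) \<in> lenlex r \<or> (snd q, snd p) \<in> lenlex r"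
      using total_lenlex[OF total] by (meson UNIV_I total_on_def)
    ultimately show "p = q \<or> (p, q) \<in> L \<or> (q, p) \<in> L"
      unfolding L_def path_source_def by (auto intro: prod_eqI)
  next
    fix p q a c :: "('v, 'e) qpath"
    assume pq: "(p, q) \<in> L" and ac: "a \<in> paths Q" "c \<in> paths Q" "composable Q a q" "composable Q q c"
    then have p: "composable Q a p" "composable Q p c" "p \<in> paths Q" "q \<in> paths Q"
      "(snd p, snd q) \<in> lenlex r"
      unfolding L_def composable_def by simp_all
    have in_paths: "path_comp (path_comp a u) c \<in> paths Q"
      if "u \<in> paths Q" "composable Q a u" "composable Q u c" for u
      using that ac by (simp add: path_comp_in_paths assms composable_comp_left)
    have target: "path_target Q (path_comp (path_comp a u) c) = path_target Q c"
      if "composable Q a u" "composable Q u c" for u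
    proof -
      have "composable Q (path_comp a u) c" using that by (simp add: composable_comp_left)
      \<comment> \<open>Composability with the trivial path at \<open>w\<close> says that the target
        is \<open>w\<close>, so the target is read off without unfolding walks.\<close>
      from composable_comp_left[OF this, of "(path_target Q c, [])"] show ?thesis
        by (simp add: composable_def path_source_def)
    qed
    show "(path_comp (path_comp a p) c, path_comp (path_comp a q) c) \<in> L"
      unfolding L_def mem_Collect_eq case_prod_conv
      using in_paths target p ac lenlex_append_both[OF irrefl p(5)]
      by (simp add: path_source_def path_comp_def)
  qed (auto simp: L_def)
  then show ?thesis by blast
qed

theorem proposition2p7:
  fixes Q :: "('v, 'e) pre_digraph"
    and I :: "(('v, 'e) qpath \<Rightarrow>\<^sub>0 'k::field) set"
  assumes "wf_digraph Q"
    and "finite (verts Q)"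
    and "ideal I (path_algebra Q)"
  shows "\<exists>R. reduction_system Q R \<and> diamond_condition Q R I"
proof -
  obtain L where "path_order Q L" using ex_path_order[OF assms(1)] by blast
  then interpret ordered_path_ideal Q L I
    by (intro ordered_path_ideal.intro path_ideal.intro assms)
  show ?thesis
    using reduction_system_red_sys diamond_condition_red_sys by blast
qed

end
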